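(* For any integers $a\geq 2$ and $b\geq 2$ the diffeomorphism group of $T^a\times S^b$ is not Jordan.
   Context: $T^a=(S^1)^a$ is the $a$-dimensional torus and $S^b$ is the $b$-dimensional sphere. A group $G$ is Jordan if there is a constant $C$ such that any finite subgroup $\Gamma$ of $G$ contains an abelian subgroup whose index in $\Gamma$ is at most $C$. *)

theory Defs
  imports "HOL-Analysis.Analysis" "HOL-Algebra.Bij" "HOL-Algebra.Coset"
begin

section \<open>Jordan groups\<close>

text \<open>
  Abelian subgroups are required to be subgroups of the finite group
  \<open>\<Gamma>\<close>, so the index is the number of their cosets inside \<open>\<Gamma>\<close>.
\<close>

definition jordan_group :: "('g, 'm) monoid_scheme \<Rightarrow> bool" where
  "jordan_group G \<longleftrightarrow>
     (\<exists>C::nat. \<forall>\<Gamma>. subgroup \<Gamma> G \<and> finite \<Gamma> \<longrightarrow>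
        (\<exists>A. subgroup A (G\<lparr>carrier := \<Gamma>\<rparr>) \<and> comm_group (G\<lparr>carrier := A\<rparr>) \<and>
             card (rcosets\<^bsub>G\<lparr>carrier := \<Gamma>\<rparr>\<^esub> A) \<le> C))"


section \<open>Smooth maps between subsets of Euclidean spaces\<close>

text \<open>
  The recursion runs over directional derivatives, which keeps the type of the
  function fixed. As the domain is finite-dimensional, this is the usual class
  of \<open>k\<close> times continuously differentiable functions on an open set \<open>U\<close>.
\<close>

primrec Ck_on :: "nat \<Rightarrow> ('a::euclidean_space \<Rightarrow> 'b::real_normed_vector) \<Rightarrow> 'a set \<Rightarrow> bool" where
  "Ck_on 0 f U \<longleftrightarrow> continuous_on U f"
| "Ck_on (Suc k) f U \<longleftrightarrow>
     (\<forall>x\<in>U. f differentiable (at x)) \<and>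
     (\<forall>v. Ck_on k (\<lambda>x. frechet_derivative f (at x) v) U)"

definition Cinf_on :: "('a::euclidean_space \<Rightarrow> 'b::real_normed_vector) \<Rightarrow> 'a set \<Rightarrow> bool" where
  "Cinf_on f U \<longleftrightarrow> (\<forall>k. Ck_on k f U)"

text \<open>
  Smoothness on an arbitrary subset \<open>M\<close> means local extendability to a smooth map
  on an open subset of the ambient space. For an embedded submanifold \<open>M\<close> this is
  smoothness with respect to its standard differentiable structure.
\<close>

definition smooth_map_on :: "'a::euclidean_space set \<Rightarrow> ('a \<Rightarrow> 'b::euclidean_space) \<Rightarrow> bool" where
  "smooth_map_on M f \<longleftrightarrow>
     (\<forall>x\<in>M. \<exists>U F. open U \<and> x \<in> U \<and> Cinf_on F U \<and> (\<forall>y\<in>M \<inter> U. F y = f y))"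


section \<open>Diffeomorphism groups\<close>

text \<open>
  As in \<^const>\<open>Bij\<close>, the maps are \<^const>\<open>undefined\<close> outside \<open>M\<close>, so that
  each diffeomorphism of \<open>M\<close> is represented exactly once.
\<close>

definition Diff :: "'a::euclidean_space set \<Rightarrow> ('a \<Rightarrow> 'a) set" where
  "Diff M = {f \<in> Bij M. smooth_map_on M f \<and> smooth_map_on M (inv_into M f)}"

definition DiffGroup :: "'a::euclidean_space set \<Rightarrow> ('a \<Rightarrow> 'a) monoid" where
  "DiffGroup M = (BijGroup M)\<lparr>carrier := Diff M\<rparr>"


section \<open>The torus as a product of circles\<close>

definition torus :: "(complex ^ 'n) set" where
  "torus = {z. \<forall>i. z $ i \<in> sphere 0 1}"


section \<open>The diffeomorphisms form a group\<close>

lemma Ck_on_subset: "Ck_on k f U \<Longrightarrow> V \<subseteq> U \<Longrightarrow> Ck_on k f V"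
  by (induction k arbitrary: f) (auto intro: continuous_on_subset)

lemma Ck_on_SucD: "Ck_on (Suc k) f U \<Longrightarrow> Ck_on k f U"
proof (induction k arbitrary: f)
  case 0
  then show ?case
    by (auto intro!: continuous_at_imp_continuous_on differentiable_imp_continuous_within)
next
  case (Suc k)
  then show ?case by (metis Ck_on.simps(2))
qed

lemma Ck_on_cong:
  assumes "open U" "\<And>x. x \<in> U \<Longrightarrow> f x = g x" "Ck_on k f U"
  shows "Ck_on k g U"
  using assms(2,3)
proof (induction k arbitrary: f g)
  case 0
  then show ?case by (simp cong: continuous_on_cong)
next
  case (Suc k)
  have g': "(g has_derivative frechet_derivative f (at x)) (at x)" if "x \<in> U" for x
  proof -
    have "(f has_derivative frechet_derivative f (at x)) (at x)"
      using Suc.prems that by (simp add: frechet_derivative_works[symmetric])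
    then show ?thesis
      by (rule has_derivative_transform_within_open[OF _ assms(1) that]) (use Suc.prems in auto)
  qed
  have "frechet_derivative g (at x) = frechet_derivative f (at x)" if "x \<in> U" for x
    using frechet_derivative_at[OF g'[OF that]] by simp
  then have "Ck_on k (\<lambda>x. frechet_derivative g (at x) v) U" for v
    using Suc.IH[of "\<lambda>x. frechet_derivative f (at x) v" "\<lambda>x. frechet_derivative g (at x) v"] Suc.prems
    by simp
  then show ?case using g' by (auto simp: differentiable_def)
qed

lemma Ck_on_SucI:
  assumes "open U" "\<And>x. x \<in> U \<Longrightarrow> (f has_derivative f' x) (at x)"
    "\<And>v. Ck_on k (\<lambda>x. f' x v) U"
  shows "Ck_on (Suc k) f U"
proof -
  have "Ck_on k (\<lambda>x. frechet_derivative f (at x) v) U" for v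
    by (rule Ck_on_cong[OF assms(1) _ assms(3)[of v]])
       (simp add: frechet_derivative_at[OF assms(2), symmetric])
  then show ?thesis using assms(2) by (auto simp: differentiable_def)
qed

lemma Ck_on_SucE:
  assumes "Ck_on (Suc k) f U" "x \<in> U"
  shows "(f has_derivative frechet_derivative f (at x)) (at x)"
  using assms by (simp add: frechet_derivative_works[symmetric])

lemma Ck_on_const: "open U \<Longrightarrow> Ck_on k (\<lambda>x. c) U"
  by (induction k arbitrary: c) (auto simp: frechet_derivative_const)

lemma Ck_on_bounded_linear:
  assumes "bounded_linear h" "open U" "Ck_on k f U"
  shows "Ck_on k (\<lambda>x. h (f x)) U"
  using assms(3)
proof (induction k arbitrary: f)
  case 0
  then show ?case using bounded_linear.continuous_on[OF assms(1)] by simp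
next
  case (Suc k)
  show ?case
    by (rule Ck_on_SucI[OF assms(2) bounded_linear.has_derivative[OF assms(1) Ck_on_SucE[OF Suc.prems]]])
       (use Suc in auto)
qed

lemma Ck_on_add:
  assumes "open U" "Ck_on k f U" "Ck_on k g U"
  shows "Ck_on k (\<lambda>x. f x + g x) U"
  using assms(2,3)
proof (induction k arbitrary: f g)
  case 0
  then show ?case by (simp add: continuous_on_add)
next
  case (Suc k)
  show ?case
    by (rule Ck_on_SucI[OF assms(1)
            has_derivative_add[OF Ck_on_SucE[OF Suc.prems(1)] Ck_on_SucE[OF Suc.prems(2)]]])
       (use Suc in auto)
qed

lemma Ck_on_sum:
  assumes "open U" "finite I" "\<And>i. i \<in> I \<Longrightarrow> Ck_on k (f i) U"
  shows "Ck_on k (\<lambda>x. \<Sum>i\<in>I. f i x) U"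
  using assms(2,3)
  by (induction I rule: finite_induct) (auto intro: Ck_on_const Ck_on_add assms(1))

lemma Ck_on_scaleR:
  assumes "open U" "Ck_on k f U" "Ck_on k g U"
  shows "Ck_on k (\<lambda>x. f x *\<^sub>R g x) U"
  using assms(2,3)
proof (induction k arbitrary: f g)
  case 0
  then show ?case by (simp add: continuous_on_scaleR)
next
  case (Suc k)
  show ?case
  proof (rule Ck_on_SucI[OF assms(1)
            has_derivative_scaleR[OF Ck_on_SucE[OF Suc.prems(1)] Ck_on_SucE[OF Suc.prems(2)]]])
    fix v
    have *: "Ck_on k f U" "Ck_on k g U"
      using Suc.prems[THEN Ck_on_SucD] .
    show "Ck_on k (\<lambda>x. f x *\<^sub>R frechet_derivative g (at x) v
                     + frechet_derivative f (at x) v *\<^sub>R g x) U"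
      by (rule Ck_on_add[OF assms(1)]) (use Suc * in auto)
  qed
qed

lemma Ck_on_compose:
  fixes f :: "'a::euclidean_space \<Rightarrow> 'b::euclidean_space"
    and g :: "'b \<Rightarrow> 'c::real_normed_vector"
  assumes "open U" "open V" "f ` U \<subseteq> V" "Ck_on k f U" "Ck_on k g V"
  shows "Ck_on k (\<lambda>x. g (f x)) U"
  using assms(4,5)
proof (induction k arbitrary: g)
  case 0
  then show ?case using assms(3) by (auto intro: continuous_on_compose2)
next
  case (Suc k)
  let ?D = "\<lambda>x v. \<Sum>b\<in>Basis. (frechet_derivative f (at x) v \<bullet> b) *\<^sub>R frechet_derivative g (at (f x)) b"
  have *: "((\<lambda>x. g (f x)) has_derivative ?D x) (at x)" if "x \<in> U" for x
  proof -
    have g: "(g has_derivative frechet_derivative g (at (f x))) (at (f x))"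
      using Ck_on_SucE[OF Suc.prems(2)] assms(3) that by blast
    have D: "((\<lambda>x. g (f x)) has_derivative
           (\<lambda>v. frechet_derivative g (at (f x)) (frechet_derivative f (at x) v))) (at x)"
      using diff_chain_at[OF Ck_on_SucE[OF Suc.prems(1) that] g] by (simp add: o_def)
    have eq: "frechet_derivative g (at (f x)) w =
        (\<Sum>b\<in>Basis. (w \<bullet> b) *\<^sub>R frechet_derivative g (at (f x)) b)" for w
    proof -
      have l: "linear (frechet_derivative g (at (f x)))"
        using g by (rule has_derivative_linear)
      have "frechet_derivative g (at (f x)) (\<Sum>b\<in>Basis. (w \<bullet> b) *\<^sub>R b) =
        (\<Sum>b\<in>Basis. (w \<bullet> b) *\<^sub>R frechet_derivative g (at (f x)) b)"
        by (simp only: linear_sum[OF l] linear_cmul[OF l])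
      then show ?thesis by (simp only: euclidean_representation)
    qed
    have "(\<lambda>v. frechet_derivative g (at (f x)) (frechet_derivative f (at x) v)) = ?D x"
      by (rule ext) (rule eq)
    with D show ?thesis by (rule subst[rotated])
  qed
  show ?case
  proof (rule Ck_on_SucI[OF assms(1) *])
    fix v
    have f: "Ck_on k f U" using Suc.prems(1) by (rule Ck_on_SucD)
    show "Ck_on k (\<lambda>x. ?D x v) U"
    proof (rule Ck_on_sum[OF assms(1) finite_Basis], rule Ck_on_scaleR[OF assms(1)])
      fix b :: 'b
      show "Ck_on k (\<lambda>x. frechet_derivative f (at x) v \<bullet> b) U"
        by (rule Ck_on_bounded_linear[OF bounded_linear_inner_left assms(1)]) (use Suc.prems(1) in simp)
      show "Ck_on k (\<lambda>x. frechet_derivative g (at (f x)) b) U"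
        by (rule Suc.IH[OF f, of "\<lambda>y. frechet_derivative g (at y) b"]) (use Suc.prems(2) in simp)
    qed
  qed
qed

lemma smooth_map_on_cong:
  assumes "smooth_map_on M f" "\<And>x. x \<in> M \<Longrightarrow> f x = g x"
  shows "smooth_map_on M g"
  using assms unfolding smooth_map_on_def by (metis IntD1)

lemma Ck_on_id: "open U \<Longrightarrow> Ck_on k (\<lambda>x. x) U"
  by (cases k) (auto simp: frechet_derivative_ident intro: Ck_on_const)

lemma smooth_map_on_id: "smooth_map_on M (\<lambda>x. x)"
  unfolding smooth_map_on_def Cinf_on_def
  by (intro ballI exI[of _ UNIV] exI[of _ "\<lambda>x. x"]) (auto intro: Ck_on_id)

lemma smooth_map_on_compose:
  assumes "smooth_map_on M f" "f ` M \<subseteq> N" "smooth_map_on N g"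
  shows "smooth_map_on M (\<lambda>x. g (f x))"
  unfolding smooth_map_on_def
proof
  fix x assume x: "x \<in> M"
  obtain U F where U: "open U" "x \<in> U" "Cinf_on F U" "\<forall>y\<in>M \<inter> U. F y = f y"
    using assms(1) x unfolding smooth_map_on_def by meson
  have "f x \<in> N" using assms(2) x by blast
  then obtain V G where V: "open V" "f x \<in> V" "Cinf_on G V" "\<forall>y\<in>N \<inter> V. G y = g y"
    using assms(3) unfolding smooth_map_on_def by meson
  let ?W = "U \<inter> F -` V"
  have "continuous_on U F"
    using U(3) Ck_on.simps(1)[of F U] by (auto simp: Cinf_on_def simp del: Ck_on.simps)
  then have W: "open ?W"
    using U(1) V(1) by (metis Int_commute continuous_on_open_vimage)
  have "Cinf_on (\<lambda>y. G (F y)) ?W"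
    unfolding Cinf_on_def
  proof
    fix k
    show "Ck_on k (\<lambda>y. G (F y)) ?W"
      by (rule Ck_on_compose[OF W V(1)])
         (use U(3) V(3) in \<open>auto simp: Cinf_on_def intro: Ck_on_subset\<close>)
  qed
  moreover have "\<forall>y\<in>M \<inter> ?W. G (F y) = g (f y)"
    using U(4) V(4) assms(2) by auto
  moreover have "x \<in> ?W" using U x V(2) by auto
  ultimately show "\<exists>U F. open U \<and> x \<in> U \<and> Cinf_on F U \<and> (\<forall>y\<in>M \<inter> U. F y = g (f y))"
    using W by (intro exI[of _ ?W] exI[of _ "\<lambda>y. G (F y)"]) blast
qed

lemma subgroup_Diff: "subgroup (Diff M) (BijGroup M)"
proof (rule group.subgroupI[OF group_BijGroup])
  show "Diff M \<subseteq> carrier (BijGroup M)"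
    by (auto simp: Diff_def BijGroup_def)
  have bij: "bij_betw f M M" if "f \<in> Bij M" for f
    using that by (simp add: Bij_def)
  have "inv_into M (\<lambda>x\<in>M. x) x = x" if "x \<in> M" for x
    using that by (intro inv_into_f_eq) (auto simp: inj_on_def)
  then have "smooth_map_on M (inv_into M (\<lambda>x\<in>M. x))"
    by (intro smooth_map_on_cong[OF smooth_map_on_id]) simp
  moreover have "smooth_map_on M (\<lambda>x\<in>M. x)"
    by (rule smooth_map_on_cong[OF smooth_map_on_id]) simp
  ultimately have "(\<lambda>x\<in>M. x) \<in> Diff M"
    unfolding Diff_def using id_Bij by blast
  then show "Diff M \<noteq> {}" by blast
  fix f assume f: "f \<in> Diff M"
  then have fB: "f \<in> Bij M" by (simp add: Diff_def)
  note bf = bij[OF fB]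
  let ?i = "restrict (inv_into M f) M"
  have "inv\<^bsub>BijGroup M\<^esub> f = ?i"
    using fB by (intro group.inv_equality[OF group_BijGroup])
      (auto simp: BijGroup_def restrict_inv_into_Bij Bij_compose_restrict_eq)
  moreover have ii: "inv_into M ?i x = f x" if "x \<in> M" for x
  proof (rule inv_into_f_eq)
    show "inj_on ?i M" using bij[OF restrict_inv_into_Bij[OF fB]] by (simp add: bij_betw_def)
    show "f x \<in> M" using bf that by (auto simp: bij_betw_def)
    then show "?i (f x) = x" using bf that by (simp add: bij_betw_def inv_into_f_f)
  qed
  moreover have "smooth_map_on M (inv_into M ?i)"
  proof (rule smooth_map_on_cong[of M f])
    show "smooth_map_on M f" using f by (simp add: Diff_def)
  qed (simp only: ii)
  moreover have "smooth_map_on M ?i"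
  proof (rule smooth_map_on_cong[of M "inv_into M f"])
    show "smooth_map_on M (inv_into M f)" using f by (simp add: Diff_def)
  qed simp
  ultimately show "inv\<^bsub>BijGroup M\<^esub> f \<in> Diff M"
    using restrict_inv_into_Bij[OF fB] by (simp add: Diff_def)
  fix g assume g: "g \<in> Diff M"
  then have gB: "g \<in> Bij M" by (simp add: Diff_def)
  note bg = bij[OF gB]
  have inv_eq: "inv_into M (compose M f g) x = inv_into M g (inv_into M f x)" if "x \<in> M" for x
  proof (rule inv_into_f_eq)
    show "inj_on (compose M f g) M"
      using bij[OF compose_Bij[OF fB gB]] by (simp add: bij_betw_def)
    have fx: "inv_into M f x \<in> M"
      using bf that by (simp add: bij_betw_def inv_into_into)
    then show gx: "inv_into M g (inv_into M f x) \<in> M"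
      using bg by (simp add: bij_betw_def inv_into_into)
    then show "compose M f g (inv_into M g (inv_into M f x)) = x"
      using bf bg fx that by (simp add: compose_def bij_betw_def f_inv_into_f)
  qed
  have sm: "smooth_map_on M f" "smooth_map_on M (inv_into M f)"
    "smooth_map_on M g" "smooth_map_on M (inv_into M g)"
    using f g by (simp_all add: Diff_def)
  have "inv_into M f ` M \<subseteq> M" "g ` M \<subseteq> M"
    using bf bg by (auto simp: bij_betw_def inv_into_into)
  note c = smooth_map_on_compose[OF sm(2) this(1) sm(4)] smooth_map_on_compose[OF sm(3) this(2) sm(1)]
  have "smooth_map_on M (inv_into M (compose M f g))"
    by (rule smooth_map_on_cong[OF c(1)]) (simp only: inv_eq)
  moreover have "smooth_map_on M (compose M f g)"
    by (rule smooth_map_on_cong[OF c(2)]) (simp add: compose_eq)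
  ultimately have "compose M f g \<in> Diff M"
    using compose_Bij[OF fB gB] by (simp add: Diff_def)
  then show "f \<otimes>\<^bsub>BijGroup M\<^esub> g \<in> Diff M"
    using fB gB by (simp add: BijGroup_def)
qed

theorem group_DiffGroup: "group (DiffGroup M)"
  unfolding DiffGroup_def
  by (rule subgroup.subgroup_is_group[OF subgroup_Diff group_BijGroup])

end

theory Submission
  imports Defs "HOL-Complex_Analysis.Cauchy_Integral_Formula"
begin

text \<open>
  Glue \<open>\<real> \<times> S\<^sup>1 \<times> S\<^sup>b\<close> by \<open>(x, y, v) \<sim> (x + 1, y, y\<^sup>2\<^sup>n v)\<close>, where unit complex numbers rotate the first
  two coordinates of the sphere. Since the fundamental group of \<open>SO(b + 1)\<close> has order 2 for
  \<open>b \<ge> 2\<close>, this bundle over the 2-torus is trivial: an explicit family of rotations \<open>H\<close> with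
  \<open>H(x + 1, y) = H(x, y) y\<^sup>-\<^sup>2\<^sup>n\<close> identifies it with \<open>T\<^sup>2 \<times> S\<^sup>b\<close>. On the glued space, with \<open>\<omega>\<close> a primitive
  \<open>n\<close>-th root of unity, the maps \<open>X(x, y, v) = (x + 1/n, y, y\<^sup>2 v)\<close> and \<open>Y(x, y, v) = (x, \<omega> y, v)\<close> generate
  a finite Heisenberg group: their commutator is the central rotation by \<open>\<omega>\<^sup>2\<close>. An abelian subgroup
  of index at most \<open>C\<close> would contain \<open>X\<^sup>i\<close> and \<open>Y\<^sup>j\<close> for some \<open>1 \<le> i, j \<le> C\<close>, forcing \<open>n\<close> to divide
  \<open>2 i j\<close>, which fails for \<open>n > 2 C\<^sup>2\<close>. The remaining circle factors are fixed pointwise.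
\<close>

section \<open>A criterion for not being Jordan\<close>

text \<open>Pigeonhole: the powers of \<open>x\<close> with exponents 0 to \<open>C\<close> lie in
  at most \<open>C\<close> cosets, so two of them share a coset and their quotient lies in
  \<open>A\<close>.\<close>

lemma (in group) pow_mem_of_card_rcosets_le:
  assumes "finite (carrier G)" "subgroup A G" "card (rcosets A) \<le> C" "x \<in> carrier G"
  obtains i where "1 \<le> i" "i \<le> C" "x [^] (i::nat) \<in> A"
proof -
  let ?c = "\<lambda>i::nat. A #> x [^] i"
  have sub: "?c ` {..C} \<subseteq> rcosets A"
    using assms(4) by (auto simp: RCOSETS_def)
  \<comment> \<open>\<open>card\<close> is 0 on infinite sets, so the index bound is informative
    only together with finiteness.\<close>
  have "finite (rcosets A)"
    using assms(1) by (simp add: RCOSETS_def)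
  then have "card (?c ` {..C}) < card {..C}"
    using card_mono[OF _ sub] assms(3) by simp
  then have "\<not> inj_on ?c {..C}"
    by (rule pigeonhole)
  then obtain i j where ij: "i < j" "j \<le> C" "?c i = ?c j"
    unfolding inj_on_def by (metis atMost_iff linorder_neqE_nat)
  have "x [^] j \<in> A #> x [^] i"
    using ij(3) assms(2,4) rcos_self by simp
  moreover have "x [^] j = x [^] (j - i) \<otimes> x [^] i"
    using ij(1) assms(4) by (simp add: nat_pow_mult)
  ultimately have "x [^] (j - i) \<in> A"
    using assms(2,4) unfolding r_coset_def
    by (auto simp: subgroup.mem_carrier)
  with ij show thesis
    by (intro that[of "j - i"]) auto
qed

text \<open>An abelian subgroup of index at most \<open>C\<close> would contain such powers of both
  \<open>x\<close> and \<open>y\<close>, which would then commute. The finite group may depend on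
  \<open>C\<close>.\<close>

lemma not_jordan_groupI:
  assumes "group G"
    and "\<And>C. \<exists>\<Gamma> x y. subgroup \<Gamma> G \<and> finite \<Gamma> \<and> x \<in> \<Gamma> \<and> y \<in> \<Gamma> \<and>
      (\<forall>i j. 1 \<le> i \<and> i \<le> C \<and> 1 \<le> j \<and> j \<le> C \<longrightarrow>
        x [^]\<^bsub>G\<^esub> i \<otimes>\<^bsub>G\<^esub> y [^]\<^bsub>G\<^esub> j \<noteq> y [^]\<^bsub>G\<^esub> j \<otimes>\<^bsub>G\<^esub> x [^]\<^bsub>G\<^esub> (i::nat))"
  shows "\<not> jordan_group G"
proof
  assume "jordan_group G"
  then obtain C where C: "\<And>\<Gamma>. subgroup \<Gamma> G \<Longrightarrow> finite \<Gamma> \<Longrightarrow>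
        (\<exists>A. subgroup A (G\<lparr>carrier := \<Gamma>\<rparr>) \<and> comm_group (G\<lparr>carrier := A\<rparr>) \<and>
             card (rcosets\<^bsub>G\<lparr>carrier := \<Gamma>\<rparr>\<^esub> A) \<le> C)"
    unfolding jordan_group_def by blast
  obtain \<Gamma> x y where g: "subgroup \<Gamma> G" "finite \<Gamma>" "x \<in> \<Gamma>" "y \<in> \<Gamma>"
    and nc: "\<And>i j. 1 \<le> i \<Longrightarrow> i \<le> C \<Longrightarrow> 1 \<le> j \<Longrightarrow> j \<le> C \<Longrightarrow>
        x [^]\<^bsub>G\<^esub> i \<otimes>\<^bsub>G\<^esub> y [^]\<^bsub>G\<^esub> j \<noteq> y [^]\<^bsub>G\<^esub> j \<otimes>\<^bsub>G\<^esub> x [^]\<^bsub>G\<^esub> (i::nat)"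
    using assms(2)[of C] by blast
  obtain A where A: "subgroup A (G\<lparr>carrier := \<Gamma>\<rparr>)" "comm_group (G\<lparr>carrier := A\<rparr>)"
      "card (rcosets\<^bsub>G\<lparr>carrier := \<Gamma>\<rparr>\<^esub> A) \<le> C"
    using C g by blast
  interpret \<Gamma>: group "G\<lparr>carrier := \<Gamma>\<rparr>"
    by (rule subgroup.subgroup_is_group[OF g(1) assms(1)])
  have pow: "z [^]\<^bsub>G\<lparr>carrier := \<Gamma>\<rparr>\<^esub> k = z [^]\<^bsub>G\<^esub> k" for z and k :: nat
    by (simp add: nat_pow_def)
  obtain i where i: "1 \<le> i" "i \<le> C" "x [^]\<^bsub>G\<^esub> i \<in> A"
    using \<Gamma>.pow_mem_of_card_rcosets_le[OF _ A(1,3), of x] g unfolding pow by auto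
  obtain j where j: "1 \<le> j" "j \<le> C" "y [^]\<^bsub>G\<^esub> j \<in> A"
    using \<Gamma>.pow_mem_of_card_rcosets_le[OF _ A(1,3), of y] g unfolding pow by auto
  have "x [^]\<^bsub>G\<^esub> i \<otimes>\<^bsub>G\<^esub> y [^]\<^bsub>G\<^esub> j = y [^]\<^bsub>G\<^esub> j \<otimes>\<^bsub>G\<^esub> x [^]\<^bsub>G\<^esub> i"
    using comm_monoid.m_comm[OF comm_group.axioms(1)[OF A(2)]] i(3) j(3) by simp
  with nc i j show False by blast
qed


section \<open>Calculus of smooth maps\<close>

text \<open>Serves maps whose smooth formula exists only near each point: \<open>triv\<close> around
  an integer, \<open>act\<close> around a chosen lift.\<close>

lemma smooth_map_on_local:
  assumes "\<And>x. x \<in> M \<Longrightarrow> \<exists>U. open U \<and> x \<in> U \<and> smooth_map_on (M \<inter> U) f"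
  shows "smooth_map_on M f"
  unfolding smooth_map_on_def
proof
  fix x assume x: "x \<in> M"
  obtain U where U: "open U" "x \<in> U" "smooth_map_on (M \<inter> U) f"
    using assms[OF x] by blast
  obtain V F where V: "open V" "x \<in> V" "Cinf_on F V" "\<forall>y\<in>M \<inter> U \<inter> V. F y = f y"
    using U x unfolding smooth_map_on_def by (meson IntI)
  have "Cinf_on F (U \<inter> V)"
    using V(3) by (auto simp: Cinf_on_def intro: Ck_on_subset)
  with U V show "\<exists>U F. open U \<and> x \<in> U \<and> Cinf_on F U \<and> (\<forall>y\<in>M \<inter> U. F y = f y)"
    by (intro exI[of _ "U \<inter> V"] exI[of _ F]) auto
qed

lemma smooth_map_on_Cinf:
  assumes "open U" "Cinf_on f U" "M \<subseteq> U"
  shows "smooth_map_on M f"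
  using assms unfolding smooth_map_on_def by blast

lemma smooth_map_on_Cinf_compose:
  assumes "open V" "Cinf_on g V" "smooth_map_on M f" "\<And>x. x \<in> M \<Longrightarrow> f x \<in> V"
  shows "smooth_map_on M (\<lambda>x. g (f x))"
  by (rule smooth_map_on_compose[OF assms(3) _ smooth_map_on_Cinf[OF assms(1,2) subset_refl]])
     (use assms(4) in auto)

lemma smooth_map_on_const: "smooth_map_on M (\<lambda>x. c)"
  by (rule smooth_map_on_Cinf[of UNIV]) (auto simp: Cinf_on_def Ck_on_const)

lemma Ck_on_linear: "bounded_linear h \<Longrightarrow> open U \<Longrightarrow> Ck_on k h U"
  using Ck_on_bounded_linear[of h U k "\<lambda>x. x"] by (simp add: Ck_on_id)

lemma smooth_map_on_bounded_linear:
  assumes "bounded_linear h" "smooth_map_on M f"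
  shows "smooth_map_on M (\<lambda>x. h (f x))"
  by (rule smooth_map_on_Cinf_compose[of UNIV, OF _ _ assms(2)])
     (auto simp: Cinf_on_def Ck_on_linear assms(1))

lemmas smooth_map_on_fst = smooth_map_on_bounded_linear[OF bounded_linear_fst]
  and smooth_map_on_snd = smooth_map_on_bounded_linear[OF bounded_linear_snd]
  and smooth_map_on_Re = smooth_map_on_bounded_linear[OF bounded_linear_Re]
  and smooth_map_on_Im = smooth_map_on_bounded_linear[OF bounded_linear_Im]
  and smooth_map_on_cnj = smooth_map_on_bounded_linear[OF bounded_linear_cnj]
  and smooth_map_on_of_real = smooth_map_on_bounded_linear[OF bounded_linear_of_real]
  and smooth_map_on_vec_nth = smooth_map_on_bounded_linear[OF bounded_linear_vec_nth]

lemma smooth_map_on_Pair: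
  assumes "smooth_map_on M f" "smooth_map_on M g"
  shows "smooth_map_on M (\<lambda>x. (f x, g x))"
  unfolding smooth_map_on_def
proof
  fix x assume x: "x \<in> M"
  obtain U F where U: "open U" "x \<in> U" "Cinf_on F U" "\<forall>y\<in>M \<inter> U. F y = f y"
    using assms(1) x unfolding smooth_map_on_def by meson
  obtain V G where V: "open V" "x \<in> V" "Cinf_on G V" "\<forall>y\<in>M \<inter> V. G y = g y"
    using assms(2) x unfolding smooth_map_on_def by meson
  \<comment> \<open>Writing the pair as a sum of two linear embeddings reduces it to the rules for
    sums and linear maps.\<close>
  have "Ck_on k (\<lambda>y. (F y, 0) + (0, G y)) (U \<inter> V)" for k
  proof (rule Ck_on_add)
    have "Ck_on k F (U \<inter> V)" "Ck_on k G (U \<inter> V)"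
      using U(3) V(3) by (auto simp: Cinf_on_def intro: Ck_on_subset)
    then show "Ck_on k (\<lambda>y. (F y, 0)) (U \<inter> V)" "Ck_on k (\<lambda>y. (0, G y)) (U \<inter> V)"
      using U(1) V(1)
      by (auto intro!: Ck_on_bounded_linear[of "\<lambda>y. (y, 0)"] Ck_on_bounded_linear[of "\<lambda>y. (0, y)"]
          bounded_linear_Pair bounded_linear_ident bounded_linear_zero)
  qed (use U V in auto)
  then have "Cinf_on (\<lambda>y. (F y, G y)) (U \<inter> V)"
    by (simp add: Cinf_on_def)
  with U V show "\<exists>U H. open U \<and> x \<in> U \<and> Cinf_on H U \<and> (\<forall>y\<in>M \<inter> U. H y = (f y, g y))"
    by (intro exI[of _ "U \<inter> V"] exI[of _ "\<lambda>y. (F y, G y)"]) auto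
qed

lemma smooth_map_on_add:
  assumes "smooth_map_on M f" "smooth_map_on M g"
  shows "smooth_map_on M (\<lambda>x. f x + g x)"
  using smooth_map_on_bounded_linear[OF bounded_linear_add[OF bounded_linear_fst bounded_linear_snd]
      smooth_map_on_Pair[OF assms]] by simp

lemma smooth_map_on_diff:
  assumes "smooth_map_on M f" "smooth_map_on M g"
  shows "smooth_map_on M (\<lambda>x. f x - g x)"
  using smooth_map_on_bounded_linear[OF bounded_linear_sub[OF bounded_linear_fst bounded_linear_snd]
      smooth_map_on_Pair[OF assms]] by simp

lemma smooth_map_on_scaleR:
  assumes "smooth_map_on M f" "smooth_map_on M g"
  shows "smooth_map_on M (\<lambda>x. f x *\<^sub>R g x)"
proof -
  have "Cinf_on (\<lambda>y. fst y *\<^sub>R snd y) UNIV"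
    unfolding Cinf_on_def
    by (intro allI Ck_on_scaleR[OF open_UNIV] Ck_on_linear open_UNIV bounded_linear_fst bounded_linear_snd)
  from smooth_map_on_Cinf_compose[OF open_UNIV this smooth_map_on_Pair[OF assms]]
  show ?thesis by simp
qed

lemma smooth_map_on_mult_real:
  fixes f g :: "_ \<Rightarrow> real"
  assumes "smooth_map_on M f" "smooth_map_on M g"
  shows "smooth_map_on M (\<lambda>x. f x * g x)"
  using smooth_map_on_scaleR[OF assms] by simp

lemma smooth_map_on_mult_complex:
  fixes f g :: "_ \<Rightarrow> complex"
  assumes "smooth_map_on M f" "smooth_map_on M g"
  shows "smooth_map_on M (\<lambda>x. f x * g x)"
proof -
  have "smooth_map_on M (\<lambda>x. Re (f x) *\<^sub>R g x + Im (f x) *\<^sub>R (\<i> * g x))"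
    by (intro smooth_map_on_add smooth_map_on_scaleR smooth_map_on_Re smooth_map_on_Im assms
        smooth_map_on_bounded_linear[OF bounded_linear_mult_right])
  then show ?thesis
    by (rule smooth_map_on_cong) (simp add: complex_eq_iff)
qed

lemma smooth_map_on_sum:
  assumes "finite I" "\<And>i. i \<in> I \<Longrightarrow> smooth_map_on M (f i)"
  shows "smooth_map_on M (\<lambda>x. \<Sum>i\<in>I. f i x)"
  using assms
  by (induction I rule: finite_induct) (auto intro: smooth_map_on_const smooth_map_on_add)

lemma smooth_map_on_vec_lambda:
  fixes f :: "'i::finite \<Rightarrow> 'm::euclidean_space \<Rightarrow> 'b::euclidean_space"
  assumes "\<And>i. smooth_map_on M (f i)"
  shows "smooth_map_on M (\<lambda>x. \<chi> i. f i x)"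
proof -
  have l: "bounded_linear (axis i :: 'b \<Rightarrow> 'b^'i)" for i
  proof -
    have "linear (axis i :: 'b \<Rightarrow> 'b^'i)"
      by (rule linearI) (auto simp: vec_eq_iff axis_def)
    then show ?thesis by (rule linear_conv_bounded_linear[THEN iffD1])
  qed
  have "smooth_map_on M (\<lambda>x. \<Sum>i\<in>UNIV. axis i (f i x))"
    by (intro smooth_map_on_sum smooth_map_on_bounded_linear[OF l] assms) auto
  moreover have "(\<lambda>x. \<Sum>i\<in>UNIV. axis i (f i x)) = (\<lambda>x. \<chi> i. f i x)"
    by (simp add: vec_eq_iff axis_def if_distrib[of "\<lambda>v. v $ _"] fun_eq_iff)
  ultimately show ?thesis by simp
qed

text \<open>The real derivative in direction \<open>v\<close> is multiplication of \<open>v\<close>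
  by \<open>deriv f x\<close>, and \<open>deriv f\<close> is again holomorphic, so the induction
  closes.\<close>

lemma Ck_on_holomorphic:
  assumes "open U" "f holomorphic_on U"
  shows "Ck_on k f U"
  using assms(2)
proof (induction k arbitrary: f)
  case 0
  then show ?case by (simp add: holomorphic_on_imp_continuous_on)
next
  case (Suc k)
  show ?case
  proof (rule Ck_on_SucI[OF assms(1)])
    show "(f has_derivative (\<lambda>v. deriv f x * v)) (at x)" if "x \<in> U" for x
      using holomorphic_derivI[OF Suc.prems assms(1) that]
      by (simp add: has_field_derivative_def)
    show "Ck_on k (\<lambda>x. deriv f x * v) U" for v
      using Ck_on_bounded_linear[OF bounded_linear_mult_left assms(1)
          Suc.IH[OF holomorphic_deriv[OF Suc.prems assms(1)]]] .
  qed
qed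

lemma smooth_map_on_holomorphic_compose:
  assumes "open V" "g holomorphic_on V" "smooth_map_on M f" "\<And>x. x \<in> M \<Longrightarrow> f x \<in> V"
  shows "smooth_map_on M (\<lambda>x. g (f x))"
  by (rule smooth_map_on_Cinf_compose[OF assms(1) _ assms(3,4)])
     (auto simp: Cinf_on_def Ck_on_holomorphic assms(1,2))

lemma smooth_map_on_inverse:
  fixes f :: "_ \<Rightarrow> complex"
  assumes "smooth_map_on M f" "\<And>x. x \<in> M \<Longrightarrow> f x \<noteq> 0"
  shows "smooth_map_on M (\<lambda>x. inverse (f x))"
  by (rule smooth_map_on_holomorphic_compose[of "- {0}", OF _ _ assms(1)])
     (auto intro!: holomorphic_intros assms(2))

lemma smooth_map_on_power_int:
  fixes f :: "_ \<Rightarrow> complex"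
  assumes "smooth_map_on M f" "\<And>x. x \<in> M \<Longrightarrow> f x \<noteq> 0"
  shows "smooth_map_on M (\<lambda>x. f x powi k)"
  by (rule smooth_map_on_holomorphic_compose[of "- {0}" "\<lambda>z. z powi k", OF _ _ assms(1)])
     (auto intro!: holomorphic_intros assms(2))

lemmas smooth_map_on_intros = smooth_map_on_id smooth_map_on_const smooth_map_on_fst smooth_map_on_snd
  smooth_map_on_Re smooth_map_on_Im smooth_map_on_cnj smooth_map_on_of_real smooth_map_on_vec_nth
  smooth_map_on_Pair smooth_map_on_add smooth_map_on_diff
  smooth_map_on_mult_real smooth_map_on_mult_complex smooth_map_on_vec_lambda
  smooth_map_on_inverse smooth_map_on_power_int


section \<open>A smooth path of unit complex numbers\<close>

text \<open>
  \<open>flat k x\<close> is \<open>x\<close> to the power \<open>-k\<close> times \<open>exp (-1/x)\<close> for \<open>x > 0\<close>. The family over all \<open>k\<close> is closed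
  under differentiation up to linear combinations, whence smoothness at \<open>0\<close>.
\<close>

definition flat :: "nat \<Rightarrow> real \<Rightarrow> real" where
  "flat k x = (if x > 0 then inverse x ^ k / exp (inverse x) else 0)"

text \<open>With s = 1/x the right-hand limit is that of s^k / exp s at infinity; on the left the
  function vanishes.\<close>

lemma flat_tendsto_0: "(flat k \<longlongrightarrow> 0) (at 0)"
proof (rule filterlim_split_at)
  have "((\<lambda>x. inverse x ^ k / exp (inverse x)) \<longlongrightarrow> (0::real)) (at_right 0)"
    by (rule filterlim_compose[OF tendsto_power_div_exp_0 filterlim_inverse_at_top_right])
  then show "(flat k \<longlongrightarrow> 0) (at_right 0)"
    by (rule Lim_transform_eventually) (auto simp: flat_def eventually_at_filter)
  show "(flat k \<longlongrightarrow> 0) (at_left 0)"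
    by (rule Lim_transform_eventually[of "\<lambda>_. 0"]) (auto simp: flat_def eventually_at_filter)
qed

lemma flat_has_derivative:
  "(flat k has_real_derivative flat (k + 2) x - real k * flat (k + 1) x) (at x)"
proof -
  consider "x > 0" | "x < 0" | "x = 0" by linarith
  then show ?thesis
  proof cases
    case 1
    have "((\<lambda>x. inverse x ^ k / exp (inverse x)) has_real_derivative
        flat (k + 2) x - real k * flat (k + 1) x) (at x)"
    proof -
      \<comment> \<open>The exponent is truncated at \<open>k = 0\<close>, where the factor
        \<open>real k\<close> makes both sides vanish.\<close>
      have k: "real k * inverse x ^ (k - Suc 0) * inverse x = real k * inverse x ^ k"
        by (cases k) auto
      have "((\<lambda>x. inverse x ^ k / exp (inverse x)) has_real_derivative
          inverse x ^ k * inverse x ^ 2 / exp (inverse x) -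
          (real k * inverse x ^ (k - Suc 0) * inverse x) * inverse x / exp (inverse x)) (at x)"
        using 1 by (auto intro!: derivative_eq_intros simp: divide_simps power2_eq_square)
             (cases k; simp add: algebra_simps)
      then show ?thesis
        using 1 unfolding k by (simp add: flat_def power_add power2_eq_square mult_ac)
    qed
    moreover have "open {0::real<..}" "x \<in> {0<..}" using 1 by auto
    ultimately show ?thesis
      by (rule has_field_derivative_transform_within_open) (auto simp: flat_def)
  next
    case 2
    have "((\<lambda>x. 0) has_real_derivative flat (k + 2) x - real k * flat (k + 1) x) (at x)"
      using 2 by (simp add: flat_def)
    moreover have "open {..<0::real}" "x \<in> {..<0}" using 2 by auto
    ultimately show ?thesis
      by (rule has_field_derivative_transform_within_open) (auto simp: flat_def)
  next
    case 3
    \<comment> \<open>The difference quotient of \<open>flat k\<close> at 0 is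
      \<open>flat (Suc k)\<close>, so the previous limit gives derivative 0.\<close>
    have "((\<lambda>h. (flat k (0 + h) - flat k 0) / h) \<longlongrightarrow> 0) (at 0)"
      by (rule Lim_transform_eventually[OF flat_tendsto_0[of "Suc k"]])
         (auto simp: flat_def eventually_at_filter field_simps)
    then show ?thesis by (simp add: 3 DERIV_def flat_def)
  qed
qed

lemma Ck_on_flat: "Ck_on m (flat k) UNIV"
proof (induction m arbitrary: k)
  case 0
  show ?case
    using DERIV_isCont[OF flat_has_derivative] by (simp add: continuous_at_imp_continuous_on)
next
  case (Suc m)
  let ?f' = "\<lambda>x v. (flat (k + 2) x + (- real k) * flat (k + 1) x) * v"
  show ?case
  proof (rule Ck_on_SucI)
    show "(flat k has_derivative ?f' x) (at x)" for x
      using flat_has_derivative[of k x] by (simp add: has_field_derivative_def)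
    show "Ck_on m (\<lambda>x. ?f' x v) UNIV" for v
      by (intro Ck_on_bounded_linear[OF bounded_linear_mult_left] open_UNIV Ck_on_add Suc
          Ck_on_bounded_linear[OF bounded_linear_mult_right])
  qed auto
qed

text \<open>
  Normalising by \<open>w / cnj w\<close> instead of \<open>w / \<bar>w\<bar>\<close> gives exactly \<open>-1\<close> when \<open>w\<close> is imaginary and \<open>1\<close>
  when \<open>w\<close> is real, so the path is constant outside the unit interval.
\<close>

definition half_turn_base :: "real \<Rightarrow> complex" where
  "half_turn_base t = Complex (flat 0 t) (flat 0 (1 - t))"

definition half_turn :: "real \<Rightarrow> complex" where
  "half_turn t = half_turn_base t * inverse (cnj (half_turn_base t))"

text \<open>The real part is positive for \<open>t > 0\<close> and the imaginary part for
  \<open>t < 1\<close>.\<close>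

lemma half_turn_base_nonzero: "half_turn_base t \<noteq> 0"
  by (auto simp: half_turn_base_def flat_def complex_eq_iff)

lemma norm_half_turn [simp]: "norm (half_turn t) = 1"
  using half_turn_base_nonzero[of t] by (simp add: half_turn_def norm_mult norm_inverse)

lemma half_turn_nonzero [simp]: "half_turn t \<noteq> 0"
  using norm_half_turn[of t] by force

lemma half_turn_le_0: "t \<le> 0 \<Longrightarrow> half_turn t = -1"
  by (simp add: half_turn_def half_turn_base_def flat_def complex_eq_iff power2_eq_square)

lemma half_turn_ge_1: "t \<ge> 1 \<Longrightarrow> half_turn t = 1"
  by (simp add: half_turn_def half_turn_base_def flat_def complex_eq_iff power2_eq_square)

lemma smooth_map_on_half_turn:
  assumes "smooth_map_on M f"
  shows "smooth_map_on M (\<lambda>x. half_turn (f x))"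
proof -
  have fl: "smooth_map_on M (\<lambda>x. flat k (g x))" if "smooth_map_on M g" for g k
    by (rule smooth_map_on_Cinf_compose[of UNIV, OF _ _ that]) (auto simp: Cinf_on_def Ck_on_flat)
  have "smooth_map_on M (\<lambda>x. half_turn_base (f x))"
    unfolding half_turn_base_def Complex_eq
    by (intro smooth_map_on_intros fl assms)
  then show ?thesis
    unfolding half_turn_def
    by (intro smooth_map_on_intros) (auto simp: half_turn_base_nonzero)
qed


section \<open>Rotations in coordinate planes\<close>

text \<open>Reading coordinates \<open>p\<close> and \<open>q\<close> as real and imaginary part of
  a complex number, this is multiplication by \<open>u\<close>; it is a rotation when
  \<open>u\<close> has norm 1.\<close>

definition rot :: "'n \<Rightarrow> 'n \<Rightarrow> complex \<Rightarrow> real ^ 'n \<Rightarrow> real ^ 'n::finite" where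
  "rot p q u v = (\<chi> l. if l = p then Re u * v $ p - Im u * v $ q
                       else if l = q then Im u * v $ p + Re u * v $ q else v $ l)"

lemma rot_rot: "p \<noteq> q \<Longrightarrow> rot p q u (rot p q w v) = rot p q (u * w) v"
  by (simp add: rot_def vec_eq_iff algebra_simps)

lemma rot_1 [simp]: "rot p q 1 v = v"
  by (simp add: rot_def vec_eq_iff)

text \<open>The half turn negates coordinate \<open>q\<close>, so on the plane of \<open>p\<close>
  and \<open>q\<close> it acts as complex conjugation. The third axis \<open>r\<close> is where b >=
  2 enters.\<close>

lemma rot_conj_half_turn:
  assumes "p \<noteq> q" "p \<noteq> r" "q \<noteq> r"
  shows "rot q r (-1) (rot p q u (rot q r (-1) v)) = rot p q (cnj u) v"
  using assms by (simp add: rot_def vec_eq_iff)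

lemma norm_rot:
  assumes "p \<noteq> q" "norm u = 1"
  shows "norm (rot p q u v) = norm v"
proof -
  have "(Re u)\<^sup>2 + (Im u)\<^sup>2 = 1"
    using assms(2) by (simp add: cmod_def)
  moreover have "(Re u * s - Im u * t)\<^sup>2 + (Im u * s + Re u * t)\<^sup>2 = ((Re u)\<^sup>2 + (Im u)\<^sup>2) * (s\<^sup>2 + t\<^sup>2)"
    for s t by algebra
  moreover have split: "(\<Sum>l\<in>UNIV. f l) = f p + f q + (\<Sum>l\<in>UNIV - {p, q}. f l)" for f :: "_ \<Rightarrow> real"
    using assms(1) sum.remove[of UNIV p f] sum.remove[of "UNIV - {p}" q f]
    by (simp add: Diff_insert2[symmetric] insert_commute)
  ultimately show ?thesis
    using assms(1) unfolding norm_vec_def L2_set_def by (simp add: split rot_def)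
qed

lemma smooth_map_on_rot:
  assumes "smooth_map_on M f" "smooth_map_on M g"
  shows "smooth_map_on M (\<lambda>x. rot p q (f x) (g x))"
proof -
  have "smooth_map_on M (\<lambda>x. if l = p then Re (f x) * g x $ p - Im (f x) * g x $ q
                       else if l = q then Im (f x) * g x $ p + Re (f x) * g x $ q else g x $ l)" for l
    by (cases "l = p"; cases "l = q") (simp; intro smooth_map_on_intros assms)+
  then show ?thesis
    unfolding rot_def by (rule smooth_map_on_vec_lambda)
qed

text \<open>The vector \<open>axis p 1\<close> is the number 1 of the plane, so its image displays
  the multiplier itself.\<close>

lemma rot_axis_neq:
  assumes "p \<noteq> q" "u \<noteq> w"
  shows "rot p q u (axis p 1) \<noteq> rot p q w (axis p 1)"
proof
  assume "rot p q u (axis p 1) = rot p q w (axis p 1)"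
  then have "rot p q u (axis p 1) $ l = rot p q w (axis p 1) $ l" for l
    by simp
  from this[of p] this[of q] show False
    using assms by (simp add: rot_def complex_eq_iff axis_def split: if_splits)
qed

lemma cnj_eq_inverse: "norm (u::complex) = 1 \<Longrightarrow> cnj u = inverse u"
  using inverse_unique[of u "cnj u"] complex_norm_square[of u] by simp

lemma norm_powi_unit: "norm (u::complex) = 1 \<Longrightarrow> norm (u powi k) = 1"
  by (simp add: norm_power_int)

text \<open>Keeps \<open>y powi int n\<close> from becoming a natural power, so that the laws for
  integer exponents apply uniformly.\<close>

declare power_int_of_nat [simp del]


section \<open>The Heisenberg action\<close>

locale heisenberg_action =
  fixes p q r :: "'n::finite" and a0 a1 :: "'a::finite" and n :: nat
  assumes pq: "p \<noteq> q" and pr: "p \<noteq> r" and qr: "q \<noteq> r" and a01: "a0 \<noteq> a1" and n: "n > 0"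
begin

text \<open>
  For \<open>|y| = 1\<close>, the half turn in the plane \<open>(q, r)\<close> conjugates the rotation by \<open>y\<close> in the plane
  \<open>(p, q)\<close> into its inverse. So, as \<open>t\<close> runs from \<open>0\<close> to \<open>1\<close>, \<open>block t\<close> is a homotopy from the
  constant loop to the loop of rotations by \<open>y\<close> to the power \<open>-2n\<close>.
\<close>

definition block :: "real \<Rightarrow> complex \<Rightarrow> real ^ 'n \<Rightarrow> real ^ 'n" where
  "block t y v = rot q r (half_turn t) (rot p q (y powi (- int n))
     (rot q r (inverse (half_turn t)) (rot p q (y powi (- int n)) v)))"

definition block_inv :: "real \<Rightarrow> complex \<Rightarrow> real ^ 'n \<Rightarrow> real ^ 'n" where
  "block_inv t y v = rot p q (y powi (int n)) (rot q r (half_turn t)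
     (rot p q (y powi (int n)) (rot q r (inverse (half_turn t)) v)))"

lemma unit_nonzero: "norm (y::complex) = 1 \<Longrightarrow> y \<noteq> 0"
  by auto

lemma power_int_cancel:
  assumes "norm (y::complex) = 1"
  shows "y powi k * y powi (- k) = 1" "y powi (- k) * y powi k = 1"
  using unit_nonzero[OF assms] by (simp_all add: power_int_minus)

lemma block_inverse:
  assumes "norm y = 1"
  shows "block t y (block_inv t y v) = v" "block_inv t y (block t y v) = v"
  using assms pq qr by (simp_all add: block_def block_inv_def rot_rot power_int_cancel)

lemma norm_block:
  assumes "norm y = 1"
  shows "norm (block t y v) = norm v" "norm (block_inv t y v) = norm v"
  using assms pq qr by (simp_all add: block_def block_inv_def norm_rot norm_powi_unit norm_inverse)

text \<open>With \<open>half_turn t = -1\<close>, the first three factors form a conjugate, namely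
  the rotation by \<open>y powi int n\<close>, which cancels the last factor.\<close>

lemma block_le_0:
  assumes "norm y = 1" "t \<le> 0"
  shows "block t y v = v"
proof -
  have "cnj (y powi (- int n)) = y powi (int n)"
    using assms cnj_eq_inverse[OF norm_powi_unit[OF assms(1)]] by (simp add: power_int_minus)
  then show ?thesis
    using assms pq pr qr
    by (simp add: block_def half_turn_le_0 rot_conj_half_turn rot_rot power_int_cancel)
qed

lemma block_ge_1:
  assumes "norm y = 1" "t \<ge> 1"
  shows "block t y v = rot p q (y powi (- 2 * int n)) v"
  using assms pq unit_nonzero[OF assms(1)]
  by (simp add: block_def half_turn_ge_1 rot_rot power_int_add[symmetric])

lemma block_inv_le_0:
  assumes "norm y = 1" "t \<le> 0"
  shows "block_inv t y v = v"
  using block_inverse(2)[OF assms(1), of t v] block_le_0[OF assms] by simp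

section \<open>Trivialisation of the bundle by the family H\<close>

definition triv :: "real \<Rightarrow> complex \<Rightarrow> real ^ 'n \<Rightarrow> real ^ 'n" where
  "triv x y v = block (frac x) y (rot p q (y powi (- 2 * int n * \<lfloor>x\<rfloor>)) v)"

definition triv_inv :: "real \<Rightarrow> complex \<Rightarrow> real ^ 'n \<Rightarrow> real ^ 'n" where
  "triv_inv x y v = rot p q (y powi (2 * int n * \<lfloor>x\<rfloor>)) (block_inv (frac x) y v)"

lemma triv_inverse:
  assumes "norm y = 1"
  shows "triv x y (triv_inv x y v) = v" "triv_inv x y (triv x y v) = v"
  using assms pq power_int_cancel[OF assms, of "2 * int n * \<lfloor>x\<rfloor>"]
  by (simp_all add: triv_def triv_inv_def rot_rot block_inverse)

lemma norm_triv:
  assumes "norm y = 1"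
  shows "norm (triv x y v) = norm v" "norm (triv_inv x y v) = norm v"
  using assms pq by (simp_all add: triv_def triv_inv_def norm_block norm_rot norm_powi_unit)

lemma triv_add_int:
  assumes "norm y = 1"
  shows "triv (x + of_int m) y v = triv x y (rot p q (y powi (- 2 * int n * m)) v)"
proof -
  have "y powi (- 2 * int n * (\<lfloor>x\<rfloor> + m)) = y powi (- 2 * int n * \<lfloor>x\<rfloor>) * y powi (- 2 * int n * m)"
    using unit_nonzero[OF assms] by (simp add: power_int_add[symmetric] algebra_simps)
  then show ?thesis
    using pq by (simp add: triv_def rot_rot frac_def)
qed

lemma triv_inv_add_int:
  assumes "norm y = 1"
  shows "triv_inv (x + of_int m) y v = rot p q (y powi (2 * int n * m)) (triv_inv x y v)"
proof -
  have "y powi (2 * int n * (\<lfloor>x\<rfloor> + m)) = y powi (2 * int n * m) * y powi (2 * int n * \<lfloor>x\<rfloor>)"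
    using unit_nonzero[OF assms] by (simp add: power_int_add[symmetric] algebra_simps)
  then show ?thesis
    using pq by (simp add: triv_inv_def rot_rot frac_def)
qed

text \<open>
  The definition of \<open>triv\<close> through the floor function hides its smoothness at the integers; on the
  interval of radius 1 around \<open>j\<close> there is a single smooth formula, since one of the two blocks
  is always in its constant range.
\<close>

lemma triv_near_int:
  assumes "norm y = 1" "\<bar>x - of_int j\<bar> < 1"
  shows "triv x y v = block (x - of_int j) y (block (x - of_int j + 1) y
           (rot p q (y powi (2 * int n * (1 - j))) v))"
    and "triv_inv x y v = rot p q (y powi (- 2 * int n * (1 - j)))
           (block_inv (x - of_int j + 1) y (block_inv (x - of_int j) y v))"
proof -
  \<comment> \<open>Left of \<open>j\<close> the outer block is the identity. From \<open>j\<close>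
    on the inner block is the full rotation, and the powers of \<open>y\<close> combine to the
    exponent \<open>- 2 * int n * j\<close>.\<close>
  show *: "triv x y v = block (x - of_int j) y (block (x - of_int j + 1) y
           (rot p q (y powi (2 * int n * (1 - j))) v))" for v
  proof (cases "x \<ge> of_int j")
    case True
    then have "\<lfloor>x\<rfloor> = j" using assms(2) by (simp add: floor_eq_iff)
    moreover have "y powi (- 2 * int n) * y powi (2 * int n * (1 - j)) = y powi (- 2 * int n * j)"
      using unit_nonzero[OF assms(1)] by (simp add: power_int_add[symmetric] algebra_simps)
    ultimately show ?thesis
      using True assms pq by (simp add: triv_def frac_def block_ge_1 rot_rot)
  next
    case False
    then have "\<lfloor>x\<rfloor> = j - 1" using assms(2) by (simp add: floor_eq_iff)
    moreover from this have "x - of_int \<lfloor>x\<rfloor> = x - of_int j + 1" by simp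
    moreover have "- 2 * int n * (j - 1) = 2 * int n * (1 - j)" by (simp add: algebra_simps)
    ultimately show ?thesis
      using False assms by (simp only: triv_def frac_def) (simp add: block_le_0)
  qed
  let ?w = "rot p q (y powi (- 2 * int n * (1 - j)))
           (block_inv (x - of_int j + 1) y (block_inv (x - of_int j) y v))"
  \<comment> \<open>The second formula inverts the first factor by factor, which spares another case
    distinction.\<close>
  have "triv x y ?w = v"
    using power_int_cancel[OF assms(1), of "2 * int n * (1 - j)"]
    by (simp only: * rot_rot[OF pq] block_inverse[OF assms(1)] mult_minus_left rot_1)
  then show "triv_inv x y v = ?w"
    using triv_inverse(2)[OF assms(1), of x ?w] by simp
qed

lemma smooth_map_on_block:
  assumes "smooth_map_on M f" "smooth_map_on M g" "smooth_map_on M h"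
    and "\<And>x. x \<in> M \<Longrightarrow> norm (g x) = 1"
  shows "smooth_map_on M (\<lambda>x. block (f x) (g x) (h x))"
    and "smooth_map_on M (\<lambda>x. block_inv (f x) (g x) (h x))"
  unfolding block_def block_inv_def
  by (intro smooth_map_on_rot smooth_map_on_intros smooth_map_on_half_turn assms half_turn_nonzero
      unit_nonzero; assumption)+

lemma smooth_map_on_triv:
  assumes "smooth_map_on M f" "smooth_map_on M g" "smooth_map_on M h"
    and "\<And>x. x \<in> M \<Longrightarrow> norm (g x) = 1"
  shows "smooth_map_on M (\<lambda>x. triv (f x) (g x) (h x))"
    and "smooth_map_on M (\<lambda>x. triv_inv (f x) (g x) (h x))"
proof -
  \<comment> \<open>It suffices to treat the coordinate projections on \<open>?N\<close>, through
    which every triple \<open>f\<close>, \<open>g\<close>, \<open>h\<close> factors.\<close>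
  let ?N = "{m :: real \<times> complex \<times> (real^'n). norm (fst (snd m)) = 1}"
  let ?H = "\<lambda>m. triv (fst m) (fst (snd m)) (snd (snd m))"
  let ?K = "\<lambda>m. triv_inv (fst m) (fst (snd m)) (snd (snd m))"
  have loc: "\<exists>U. open U \<and> m \<in> U \<and> smooth_map_on (?N \<inter> U) ?H \<and> smooth_map_on (?N \<inter> U) ?K" for m
  proof -
    define j where "j = \<lfloor>fst m\<rfloor>"
    let ?U = "{m :: real \<times> complex \<times> (real^'n). \<bar>fst m - of_int j\<bar> < 1}"
    have "smooth_map_on (?N \<inter> ?U) (\<lambda>m. block (fst m - of_int j) (fst (snd m))
        (block (fst m - of_int j + 1) (fst (snd m))
           (rot p q (fst (snd m) powi (2 * int n * (1 - j))) (snd (snd m)))))"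
      by (intro smooth_map_on_block smooth_map_on_rot smooth_map_on_intros unit_nonzero) auto
    then have "smooth_map_on (?N \<inter> ?U) ?H"
      by (rule smooth_map_on_cong) (simp add: triv_near_int(1)[where j = j])
    moreover have "smooth_map_on (?N \<inter> ?U) (\<lambda>m. rot p q (fst (snd m) powi (- 2 * int n * (1 - j)))
           (block_inv (fst m - of_int j + 1) (fst (snd m)) 
             (block_inv (fst m - of_int j) (fst (snd m)) (snd (snd m)))))"
      by (intro smooth_map_on_block smooth_map_on_rot smooth_map_on_intros unit_nonzero) auto
    then have "smooth_map_on (?N \<inter> ?U) ?K"
      by (rule smooth_map_on_cong) (simp add: triv_near_int(2)[where j = j])
    moreover have "open ?U"
      by (intro open_Collect_less continuous_intros)
    moreover have "m \<in> ?U"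
      unfolding j_def by simp linarith
    ultimately show ?thesis by blast
  qed
  have fgh: "smooth_map_on M (\<lambda>x. (f x, g x, h x))" "(\<lambda>x. (f x, g x, h x)) ` M \<subseteq> ?N"
    using assms by (auto intro: smooth_map_on_Pair)
  have "smooth_map_on ?N ?H" "smooth_map_on ?N ?K"
    by (rule smooth_map_on_local, use loc in meson)+
  from smooth_map_on_compose[OF fgh this(1)] smooth_map_on_compose[OF fgh this(2)]
  show "smooth_map_on M (\<lambda>x. triv (f x) (g x) (h x))"
    "smooth_map_on M (\<lambda>x. triv_inv (f x) (g x) (h x))"
    by simp_all
qed

section \<open>The Heisenberg maps on the glued space\<close>

definition omega :: complex where
  "omega = cis (2 * pi / n)"

text \<open>
  In the coordinates of the mapping torus, the map is simply \<open>(x, y, v)\<close> to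
  \<open>(x + i/n, \<omega>\<^sup>j y, \<omega>\<^sup>2\<^sup>k y\<^sup>2\<^sup>i v)\<close>; conjugation by \<open>triv\<close> carries it to the product.
\<close>

definition gauge :: "int \<Rightarrow> int \<Rightarrow> int \<Rightarrow> real \<Rightarrow> complex \<Rightarrow> real ^ 'n \<Rightarrow> real ^ 'n" where
  "gauge i j k x y v = triv (x + i / n) (y * omega powi j)
     (rot p q (omega powi (2 * k) * y powi (2 * i)) (triv_inv x y v))"

lemma norm_omega [simp]: "norm omega = 1"
  by (simp add: omega_def)

lemma omega_nonzero [simp]: "omega \<noteq> 0"
  by (simp add: omega_def)

lemma omega_powi: "omega powi i = cis (2 * pi * (i / n))"
  by (simp add: omega_def cis_power_int mult_ac)

lemma omega_powi_mult_n [simp]: "omega powi (int n * i) = 1"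
  using n by (simp add: omega_powi)

text \<open>The gluing exponent is a multiple of \<open>n\<close>, so the gluing does not notice
  multiplication of \<open>y\<close> by powers of \<open>omega\<close>.\<close>

lemma power_int_mult_omega: "(y * omega powi j) powi (- 2 * int n * m) = y powi (- 2 * int n * m)"
proof -
  have "(omega powi j) powi (- 2 * int n * m) = omega powi (int n * (- 2 * m * j))"
    unfolding power_int_mult[symmetric] by (rule arg_cong[of _ _ "power_int omega"]) simp
  then show ?thesis
    by (simp only: power_int_mult_distrib omega_powi_mult_n mult_1_right)
qed

lemma norm_gauge: "norm y = 1 \<Longrightarrow> norm (gauge i j k x y v) = norm v"
  using pq by (simp add: gauge_def norm_triv norm_rot norm_mult norm_powi_unit)

text \<open>The outer \<open>triv\<close> and the inner \<open>triv_inv\<close> contribute inverse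
  powers of \<open>y\<close>; both are rotations in the same plane as the middle factor, so they
  cancel. Hence the map descends to x modulo 1.\<close>

lemma gauge_add_int:
  assumes "norm y = 1"
  shows "gauge i j k (x + of_int m) y v = gauge i j k x y v"
proof -
  have y: "y \<noteq> 0" "norm (y * omega powi j) = 1"
    using assms by (auto simp: norm_mult norm_powi_unit)
  have "(y * omega powi j) powi (- 2 * (int n * m)) = y powi (- 2 * (int n * m))"
    using power_int_mult_omega[of y j m] by (simp only: mult.assoc)
  moreover have "y powi (- 2 * (int n * m)) * (c * (d * y powi (2 * (int n * m)))) = c * d" for c d
    using power_int_cancel(2)[OF assms, of "2 * int n * m"] by (simp add: mult_ac)
  moreover have "x + of_int m + i / n = (x + i / n) + of_int m" by simp
  ultimately show ?thesis
    unfolding gauge_def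
    by (simp only: triv_add_int[OF y(2)] triv_inv_add_int[OF assms] rot_rot[OF pq] mult.assoc)
qed

text \<open>The inner trivialisations cancel. The Heisenberg term \<open>i' * j\<close> arises
  because the second map twists by \<open>y * omega powi j\<close> instead of
  \<open>y\<close>.\<close>

lemma gauge_gauge:
  assumes "norm y = 1"
  shows "gauge i' j' k' (x + i / n) (y * omega powi j) (gauge i j k x y v) =
    gauge (i + i') (j + j') (k + k' + i' * j) x y v"
proof -
  have y: "y \<noteq> 0" "norm (y * omega powi j) = 1"
    using assms by (auto simp: norm_mult norm_powi_unit)
  have "x + i / n + i' / n = x + of_int (i + i') / n" by (simp add: add_divide_distrib)
  moreover have "y * omega powi j * omega powi j' = y * omega powi (j + j')"
    by (simp add: power_int_add)
  moreover have "omega powi (2 * k') * (y * omega powi j) powi (2 * i') * (omega powi (2 * k) * y powi (2 * i)) =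
      omega powi (2 * (k + k' + i' * j)) * y powi (2 * (i + i'))"
  proof -
    have "(omega powi j) powi (2 * i') = omega powi (2 * (i' * j))"
      by (simp add: power_int_mult[symmetric] mult_ac)
    then show ?thesis
      using y(1) by (simp add: power_int_mult_distrib power_int_add distrib_left)
  qed
  ultimately show ?thesis
    unfolding gauge_def by (simp only: triv_inverse[OF y(2)] rot_rot[OF pq])
qed

lemma gauge_0:
  assumes "norm y = 1"
  shows "gauge 0 0 0 x y v = v"
  using assms by (simp add: gauge_def triv_inverse)

section \<open>Descent to the product of torus and sphere\<close>

definition arg_lift :: "complex \<Rightarrow> real" where
  "arg_lift w = Arg w / (2 * pi)"

lemma cis_arg_lift: "norm w = 1 \<Longrightarrow> cis (2 * pi * arg_lift w) = w"
  using cis_Arg[of w] by (force simp: arg_lift_def sgn_eq)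

abbreviation M :: "((complex ^ 'a) \<times> (real ^ 'n)) set" where
  "M \<equiv> torus \<times> sphere 0 1"

definition shift :: "int \<Rightarrow> int \<Rightarrow> complex ^ 'a \<Rightarrow> complex ^ 'a" where
  "shift i j z = (\<chi> l. if l = a0 then z $ a0 * omega powi i
                       else if l = a1 then z $ a1 * omega powi j else z $ l)"

definition act :: "int \<Rightarrow> int \<Rightarrow> int \<Rightarrow> (complex ^ 'a) \<times> (real ^ 'n) \<Rightarrow> (complex ^ 'a) \<times> (real ^ 'n)" where
  "act i j k m = (shift i j (fst m), gauge i j k (arg_lift (fst m $ a0)) (fst m $ a1) (snd m))"

text \<open>Two lifts of \<open>w\<close> differ by an integer, so periodicity applies. The jump of
  \<open>arg_lift\<close> is thus harmless, and any convenient lift may replace it.\<close>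

lemma gauge_arg_lift:
  assumes "norm y = 1" "cis (2 * pi * x) = w"
  shows "gauge i j k (arg_lift w) y v = gauge i j k x y v"
proof -
  have "norm w = 1" using assms(2) by force
  then have "cis (2 * pi * arg_lift w) = cis (2 * pi * x)"
    by (simp add: cis_arg_lift assms(2))
  then obtain l :: int where "2 * pi * arg_lift w = 2 * pi * x + 2 * pi * l"
    using sin_cos_eq_iff[of "2 * pi * arg_lift w" "2 * pi * x"] by (auto simp: complex_eq_iff)
  then have "2 * pi * arg_lift w = 2 * pi * (x + l)" by (simp add: distrib_left)
  then have "arg_lift w = x + l" by simp
  then show ?thesis by (simp add: gauge_add_int[OF assms(1)])
qed

lemma torusD: "z \<in> torus \<Longrightarrow> norm (z $ l) = 1"
  by (simp add: torus_def)

lemma act_mem: "m \<in> M \<Longrightarrow> act i j k m \<in> M"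
  by (auto simp: act_def torus_def shift_def norm_gauge norm_mult norm_powi_unit)

lemma act_act:
  assumes "m \<in> M"
  shows "act i' j' k' (act i j k m) = act (i + i') (j + j') (k + k' + i' * j) m"
proof -
  let ?x = "arg_lift (fst m $ a0)" and ?y = "fst m $ a1"
  have unit: "norm (fst m $ l) = 1" for l
    using assms by (auto intro: torusD)
  have y: "norm (?y * omega powi j) = 1"
    by (simp add: unit norm_mult norm_powi_unit)
  \<comment> \<open>Thus \<open>?x + i / n\<close> is a lift of the shifted first coordinate,
    although it may differ from its \<open>arg_lift\<close>.\<close>
  have "cis (2 * pi * (?x + i / n)) = fst m $ a0 * omega powi i"
    by (simp only: distrib_left cis_mult[symmetric] cis_arg_lift[OF unit] omega_powi)
  from gauge_arg_lift[OF y this]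
  have "gauge i' j' k' (arg_lift (fst m $ a0 * omega powi i)) (?y * omega powi j) (gauge i j k ?x ?y (snd m)) =
     gauge (i + i') (j + j') (k + k' + i' * j) ?x ?y (snd m)"
    by (simp add: gauge_gauge[OF unit])
  moreover have "shift i' j' (shift i j z) = shift (i + i') (j + j') z" for z
    using a01 by (simp add: shift_def vec_eq_iff power_int_add)
  ultimately show ?thesis
    using a01 by (simp add: act_def) (simp add: shift_def)
qed

lemma act_0: "m \<in> M \<Longrightarrow> act 0 0 0 m = m"
  by (cases m) (simp add: act_def shift_def gauge_0 torusD vec_eq_iff)

text \<open>For \<open>j\<close> and \<open>k\<close> this is the order of \<open>omega\<close>.
  Adding \<open>n\<close> to \<open>i\<close> moves x by 1, and the gluing power of \<open>y\<close>
  cancels the extra twist.\<close>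

lemma act_mod:
  assumes "m \<in> M"
  shows "act (i mod int n) (j mod int n) (k mod int n) m = act i j k m"
proof -
  have unit: "norm (fst m $ l) = 1" for l
    using assms by (auto intro: torusD)
  have mod: "omega powi (c * i) = omega powi (c * (i mod int n))" for c i
  proof -
    have "c * i = c * (i mod int n) + int n * (c * (i div int n))"
      by (metis (no_types, opaque_lifting) distrib_left mod_mult_div_eq mult.left_commute)
    then show ?thesis by (simp add: power_int_add)
  qed
  note mod1 = mod[of 1, simplified]
  let ?x = "arg_lift (fst m $ a0)" and ?y = "fst m $ a1"
  have "gauge i j k ?x ?y v = gauge (i mod int n) j k ?x ?y v" for v
  proof -
    define d where "d = i div int n"
    define e where "e = i mod int n"
    have i: "i = e + int n * d" by (simp add: d_def e_def)
    have y: "norm (?y * omega powi j) = 1"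
      by (simp add: unit norm_mult norm_powi_unit)
    have "?x + i / n = (?x + e / n) + of_int d"
      using n by (simp add: i field_simps)
    moreover have "?y powi (- 2 * int n * d) * (c * ?y powi (2 * i)) = c * ?y powi (2 * e)" for c
    proof -
      have "2 * e = - 2 * int n * d + 2 * i" by (simp add: i)
      then show ?thesis
        using power_int_add[of ?y "- 2 * int n * d" "2 * i"] unit_nonzero[OF unit[of a1]]
        by (simp add: mult.left_commute)
    qed
    ultimately show ?thesis
      unfolding gauge_def e_def[symmetric]
      by (simp only: triv_add_int[OF y] power_int_mult_omega rot_rot[OF pq])
  qed
  moreover have "gauge i j k ?x ?y v = gauge i (j mod int n) (k mod int n) ?x ?y v" for i v
    unfolding gauge_def using mod[of 2 k] mod1[of j] by simp
  moreover have "shift i j z = shift (i mod int n) (j mod int n) z" for z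
    using mod1[of i] mod1[of j] by (auto simp: shift_def vec_eq_iff)
  ultimately show ?thesis
    by (simp add: act_def)
qed

lemma smooth_map_on_act: "smooth_map_on M (act i j k)"
proof (rule smooth_map_on_local)
  fix m0 assume m0: "m0 \<in> M"
  define w0 where "w0 = fst m0 $ a0"
  have w0: "norm w0 = 1" "w0 \<noteq> 0"
    using m0 torusD[of "fst m0" a0] by (auto simp: w0_def)
  \<comment> \<open>A local lift through the principal logarithm, holomorphic in
    \<open>w / w0\<close> on the right half-plane, replaces the discontinuous
    \<open>arg_lift\<close>.\<close>
  define lift where "lift w = arg_lift w0 + Im (Ln (w / w0)) / (2 * pi)" for w
  define U where "U = {m :: (complex ^ 'a) \<times> (real ^ 'n). 0 < Re (fst m $ a0 / w0)}"
  have "open U"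
    unfolding U_def by (intro open_Collect_less continuous_intros) (use w0 in auto)
  moreover have "m0 \<in> U"
    using w0 by (simp add: U_def w0_def)
  moreover have "smooth_map_on (M \<inter> U) (act i j k)"
  proof (rule smooth_map_on_cong)
    have unit: "norm (fst m $ l) = 1" if "m \<in> M \<inter> U" for m l
      using that by (auto intro: torusD)
    have hol: "(\<lambda>w. Ln (w / w0)) holomorphic_on {w. 0 < Re (w / w0)}"
      using w0 by (auto intro!: holomorphic_intros simp: complex_nonpos_Reals_iff)
    have "open {w. 0 < Re (w / w0)}"
      by (intro open_Collect_less continuous_intros) (use w0 in auto)
    from smooth_map_on_holomorphic_compose[OF this hol, of "M \<inter> U" "\<lambda>m. fst m $ a0"]
    have "smooth_map_on (M \<inter> U) (\<lambda>m. Ln (fst m $ a0 / w0))"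
      by (simp add: U_def smooth_map_on_intros)
    then have "smooth_map_on (M \<inter> U) (\<lambda>m. arg_lift w0 + Im (Ln (fst m $ a0 / w0)) * (1 / (2 * pi)))"
      by (intro smooth_map_on_intros)
    then have lift: "smooth_map_on (M \<inter> U) (\<lambda>m. lift (fst m $ a0))"
      by (simp add: lift_def)
    have "smooth_map_on (M \<inter> U) (\<lambda>m. if l = a0 then fst m $ a0 * omega powi i
                       else if l = a1 then fst m $ a1 * omega powi j else fst m $ l)" for l
      by (cases "l = a0"; cases "l = a1") (simp; intro smooth_map_on_intros)+
    then have shift: "smooth_map_on (M \<inter> U) (\<lambda>m. shift i j (fst m))"
      unfolding shift_def by (rule smooth_map_on_vec_lambda)
    have gauge: "smooth_map_on (M \<inter> U) (\<lambda>m. gauge i j k (lift (fst m $ a0)) (fst m $ a1) (snd m))"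
      unfolding gauge_def
      by (intro smooth_map_on_triv smooth_map_on_rot smooth_map_on_intros lift)
         (simp_all add: unit norm_mult norm_powi_unit unit_nonzero)
    show "smooth_map_on (M \<inter> U)
        (\<lambda>m. (shift i j (fst m), gauge i j k (lift (fst m $ a0)) (fst m $ a1) (snd m)))"
      by (rule smooth_map_on_Pair[OF shift gauge])
    fix m assume m: "m \<in> M \<inter> U"
    let ?w = "fst m $ a0"
    have "cis (Im (Ln (?w / w0))) = ?w / w0"
      using cis_Arg[of "?w / w0"] unit_nonzero[OF unit[OF m]] unit[OF m, of a0] w0
      by (simp add: Arg_eq_Im_Ln sgn_eq norm_divide)
    then have "cis (2 * pi * lift ?w) = ?w"
      using w0 by (simp add: lift_def distrib_left cis_mult[symmetric] cis_arg_lift)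
    from gauge_arg_lift[OF unit[OF m] this]
    show "(shift i j (fst m), gauge i j k (lift ?w) (fst m $ a1) (snd m)) = act i j k m"
      by (simp add: act_def)
  qed
  ultimately show "\<exists>U. open U \<and> m0 \<in> U \<and> smooth_map_on (M \<inter> U) (act i j k)"
    by blast
qed

section \<open>The finite Heisenberg group of diffeomorphisms\<close>

definition diffeo :: "int \<Rightarrow> int \<Rightarrow> int \<Rightarrow> (complex ^ 'a) \<times> (real ^ 'n) \<Rightarrow> (complex ^ 'a) \<times> (real ^ 'n)" where
  "diffeo i j k = restrict (act i j k) M"

text \<open>The third index solves the composition law: \<open>i * j\<close> compensates the
  Heisenberg term \<open>- i * j\<close>.\<close>

lemma act_inverse:
  assumes "m \<in> M"
  shows "act (- i) (- j) (i * j - k) (act i j k m) = m"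
    and "act i j k (act (- i) (- j) (i * j - k) m) = m"
  using assms by (simp_all add: act_act act_0)

lemma diffeo_Diff: "diffeo i j k \<in> Diff M"
proof -
  have bij: "bij_betw (diffeo i j k) M M"
    by (rule bij_betwI[of _ _ _ "act (- i) (- j) (i * j - k)"])
       (auto simp: diffeo_def act_inverse simp del: mem_Times_iff intro!: act_mem)
  have inv: "inv_into M (diffeo i j k) m = act (- i) (- j) (i * j - k) m" if "m \<in> M" for m
    by (rule inv_into_f_eq[OF bij_betw_imp_inj_on[OF bij] act_mem[OF that]])
       (use that act_mem[OF that] act_inverse(2)[OF that] in \<open>simp add: diffeo_def del: mem_Times_iff\<close>)
  have "smooth_map_on M (inv_into M (diffeo i j k))"
    by (rule smooth_map_on_cong[OF smooth_map_on_act inv[symmetric]])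
  moreover have "smooth_map_on M (diffeo i j k)"
    by (rule smooth_map_on_cong[OF smooth_map_on_act]) (simp add: diffeo_def)
  ultimately show ?thesis
    using bij by (simp add: Diff_def Bij_def) (simp add: diffeo_def)
qed

lemma diffeo_mult:
  "diffeo i' j' k' \<otimes>\<^bsub>DiffGroup M\<^esub> diffeo i j k = diffeo (i + i') (j + j') (k + k' + i' * j)"
proof -
  have "diffeo i' j' k' \<in> Bij M" "diffeo i j k \<in> Bij M"
    using diffeo_Diff by (auto simp: Diff_def)
  then have "diffeo i' j' k' \<otimes>\<^bsub>DiffGroup M\<^esub> diffeo i j k = compose M (diffeo i' j' k') (diffeo i j k)"
    by (simp add: DiffGroup_def BijGroup_def)
  also have "\<dots> = diffeo (i + i') (j + j') (k + k' + i' * j)"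
    unfolding compose_def diffeo_def
    by (rule restrict_ext) (simp add: act_act act_mem del: mem_Times_iff)
  finally show ?thesis .
qed

lemma diffeo_one: "diffeo 0 0 0 = \<one>\<^bsub>DiffGroup M\<^esub>"
  by (auto simp: diffeo_def DiffGroup_def BijGroup_def act_0 simp del: mem_Times_iff intro!: restrict_ext)

text \<open>Indexing by all integers makes closure immediate; finiteness then comes from
  \<open>act_mod\<close>.\<close>

definition heisenberg :: "((complex ^ 'a) \<times> (real ^ 'n) \<Rightarrow> (complex ^ 'a) \<times> (real ^ 'n)) set" where
  "heisenberg = {diffeo i j k | i j k. True}"

lemma finite_heisenberg: "finite heisenberg"
proof (rule finite_subset)
  let ?I = "{0..<int n}"
  show "finite ((\<lambda>(i, j, k). diffeo i j k) ` (?I \<times> ?I \<times> ?I))" by simp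
  have "diffeo i j k \<in> (\<lambda>(i, j, k). diffeo i j k) ` (?I \<times> ?I \<times> ?I)" for i j k
  proof (rule image_eqI)
    show "diffeo i j k = (case (i mod int n, j mod int n, k mod int n) of (i, j, k) \<Rightarrow> diffeo i j k)"
      unfolding diffeo_def prod.case by (rule restrict_ext) (simp only: act_mod)
    show "(i mod int n, j mod int n, k mod int n) \<in> ?I \<times> ?I \<times> ?I"
      using n by simp
  qed
  then show "heisenberg \<subseteq> (\<lambda>(i, j, k). diffeo i j k) ` (?I \<times> ?I \<times> ?I)"
    unfolding heisenberg_def by blast
qed

lemma subgroup_heisenberg: "subgroup heisenberg (DiffGroup M)"
proof (rule group.subgroupI[OF group_DiffGroup])
  show "heisenberg \<subseteq> carrier (DiffGroup M)"
    using diffeo_Diff by (auto simp: heisenberg_def DiffGroup_def)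
  show "heisenberg \<noteq> {}" by (auto simp: heisenberg_def)
  show "f \<otimes>\<^bsub>DiffGroup M\<^esub> g \<in> heisenberg" if "f \<in> heisenberg" "g \<in> heisenberg" for f g
    using that unfolding heisenberg_def by (force simp: diffeo_mult)
  fix f assume "f \<in> heisenberg"
  then obtain i j k where f: "f = diffeo i j k" by (auto simp: heisenberg_def)
  have "inv\<^bsub>DiffGroup M\<^esub> f = diffeo (- i) (- j) (i * j - k)"
  proof (rule group.inv_equality[OF group_DiffGroup])
    show "diffeo (- i) (- j) (i * j - k) \<otimes>\<^bsub>DiffGroup M\<^esub> f = \<one>\<^bsub>DiffGroup M\<^esub>"
      by (simp add: f diffeo_mult diffeo_one)
  qed (use diffeo_Diff in \<open>simp_all add: f DiffGroup_def\<close>)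
  then show "inv\<^bsub>DiffGroup M\<^esub> f \<in> heisenberg"
    by (auto simp: heisenberg_def)
qed

lemma diffeo_pow:
  "diffeo 1 0 0 [^]\<^bsub>DiffGroup M\<^esub> (i::nat) = diffeo i 0 0"
  "diffeo 0 1 0 [^]\<^bsub>DiffGroup M\<^esub> (i::nat) = diffeo 0 i 0"
proof -
  interpret group "DiffGroup M" by (rule group_DiffGroup)
  show "diffeo 1 0 0 [^]\<^bsub>DiffGroup M\<^esub> i = diffeo i 0 0"
    by (induction i) (simp_all add: diffeo_one[symmetric] diffeo_mult add.commute)
  show "diffeo 0 1 0 [^]\<^bsub>DiffGroup M\<^esub> i = diffeo 0 i 0"
    by (induction i) (simp_all add: diffeo_one[symmetric] diffeo_mult add.commute)
qed

text \<open>The two products differ by the rotation by \<open>omega powi (2 * (i * j))\<close>;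
  equality would make \<open>n\<close> divide a number strictly between 0 and
  \<open>n\<close>.\<close>

lemma diffeo_not_commute:
  assumes "i > 0" "j > 0" "2 * (i * j) < int n"
  shows "diffeo i 0 0 \<otimes>\<^bsub>DiffGroup M\<^esub> diffeo 0 j 0 \<noteq> diffeo 0 j 0 \<otimes>\<^bsub>DiffGroup M\<^esub> diffeo i 0 0"
proof
  assume "diffeo i 0 0 \<otimes>\<^bsub>DiffGroup M\<^esub> diffeo 0 j 0 = diffeo 0 j 0 \<otimes>\<^bsub>DiffGroup M\<^esub> diffeo i 0 0"
  then have eq: "diffeo i j (i * j) = diffeo i j 0"
    by (simp add: diffeo_mult)
  \<comment> \<open>At this point the lift is 0 and y is 1, so \<open>triv_inv\<close> is the
    identity there, and \<open>axis p 1\<close> detects the rotation.\<close>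
  let ?m = "(\<chi> l. 1, axis p 1) :: (complex ^ 'a) \<times> (real ^ 'n)"
  have "?m \<in> M" by (simp add: torus_def norm_axis_1)
  then have "act i j (i * j) ?m = act i j 0 ?m"
    using fun_cong[OF eq, of ?m] by (simp only: diffeo_def restrict_apply if_True)
  then have "gauge i j (i * j) 0 1 (axis p 1) = gauge i j 0 0 1 (axis p 1)"
    by (simp add: act_def arg_lift_def)
  moreover have "triv_inv 0 1 v = v" for v
    by (simp add: triv_inv_def block_inv_le_0)
  moreover have w: "norm (omega powi j) = 1" by (simp add: norm_powi_unit)
  ultimately have "triv (i / n) (omega powi j) (rot p q (omega powi (2 * (i * j))) (axis p 1)) =
      triv (i / n) (omega powi j) (rot p q 1 (axis p 1))"
    by (simp add: gauge_def)
  then have "rot p q (omega powi (2 * (i * j))) (axis p 1) = rot p q 1 (axis p 1)"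
    using triv_inverse(2)[OF w] by metis
  then have "omega powi (2 * (i * j)) = 1"
    using rot_axis_neq[OF pq] by blast
  then have "cos (2 * pi * (of_int (2 * (i * j)) / n)) = 1"
    unfolding omega_powi by (simp add: complex_eq_iff)
  then obtain l :: int where "2 * pi * (of_int (2 * (i * j)) / n) = of_int l * 2 * pi"
    by (subst (asm) cos_one_2pi_int) blast
  then have "2 * pi * (of_int (2 * (i * j)) / n) = 2 * pi * l" by simp
  then have "of_int (2 * (i * j)) / real n = l"
    by (simp only: mult_cancel_left) simp
  then have "real_of_int (2 * (i * j)) = real_of_int (int n * l)"
    using n by (simp add: field_simps)
  then have l: "2 * (i * j) = int n * l"
    by (simp only: of_int_eq_iff)
  have "0 < i * j" using assms by simp
  then have "int n * l > 0" "int n * l < int n * 1" using l assms(3) by linarith+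
  then show False
    using n by (simp add: zero_less_mult_iff)
qed

end

theorem mainTheorem5:
  fixes a b :: nat
  assumes "a \<ge> 2" and "b \<ge> 2"
    and "CARD('a::finite) = a" and "CARD('n::finite) = b + 1"
  shows "\<not> jordan_group
    (DiffGroup ((torus :: (complex ^ 'a) set) \<times> sphere (0 :: real ^ 'n) 1))"
proof -
  obtain a0 a1 :: 'a where a01: "a0 \<noteq> a1"
  proof -
    have "card (UNIV :: 'a set) \<ge> 2" using assms by simp
    then obtain S :: "'a set" where "card S = 2"
      using obtain_subset_with_card_n by metis
    then show thesis using that by (auto simp: card_2_iff)
  qed
  obtain p q r :: 'n where pqr: "p \<noteq> q" "p \<noteq> r" "q \<noteq> r"
  proof -
    have "card (UNIV :: 'n set) \<ge> 3" using assms by simp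
    then obtain S :: "'n set" where "card S = 3"
      using obtain_subset_with_card_n by metis
    then show thesis using that by (auto simp: card_3_iff)
  qed
  show ?thesis
  proof (rule not_jordan_groupI[OF group_DiffGroup])
    fix C :: nat
    \<comment> \<open>This is the least \<open>n\<close> above \<open>2 * (C * C)\<close>, hence
      above \<open>2 * (i * j)\<close> for all exponents up to \<open>C\<close>.\<close>
    interpret heisenberg_action p q r a0 a1 "2 * (C * C) + 1"
      using a01 pqr by unfold_locales auto
    have "diffeo 1 0 0 [^]\<^bsub>DiffGroup M\<^esub> i \<otimes>\<^bsub>DiffGroup M\<^esub> diffeo 0 1 0 [^]\<^bsub>DiffGroup M\<^esub> j \<noteq>
        diffeo 0 1 0 [^]\<^bsub>DiffGroup M\<^esub> j \<otimes>\<^bsub>DiffGroup M\<^esub> diffeo 1 0 0 [^]\<^bsub>DiffGroup M\<^esub> i"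
      if "1 \<le> i" "i \<le> C" "1 \<le> j" "j \<le> C" for i j :: nat
    proof -
      have "i * j \<le> C * C" using that by (intro mult_mono) auto
      then have "2 * (int i * int j) < int (2 * (C * C) + 1)"
        unfolding of_nat_mult[symmetric] by linarith
      then show ?thesis
        unfolding diffeo_pow using that by (intro diffeo_not_commute) auto
    qed
    moreover have "diffeo i j k \<in> heisenberg" for i j k
      unfolding heisenberg_def by blast
    ultimately show "\<exists>\<Gamma> x y. subgroup \<Gamma> (DiffGroup M) \<and> finite \<Gamma> \<and> x \<in> \<Gamma> \<and> y \<in> \<Gamma> \<and>
      (\<forall>i j. 1 \<le> i \<and> i \<le> C \<and> 1 \<le> j \<and> j \<le> C \<longrightarrow>
        x [^]\<^bsub>DiffGroup M\<^esub> i \<otimes>\<^bsub>DiffGroup M\<^esub> y [^]\<^bsub>DiffGroup M\<^esub> j \<noteq>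
        y [^]\<^bsub>DiffGroup M\<^esub> j \<otimes>\<^bsub>DiffGroup M\<^esub> x [^]\<^bsub>DiffGroup M\<^esub> (i::nat))"
      using subgroup_heisenberg finite_heisenberg
      by (intro exI[of _ heisenberg] exI[of _ "diffeo 1 0 0"] exI[of _ "diffeo 0 1 0"]) auto
  qed
qed

end
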